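(* Let $A$ be an integral domain, let $\alpha:\mathbf{N}\to\mathrm{End}^*(A[q])$ and $u:\mathbf{N}\to\mathbf{N}$ be homomorphisms, let $P$ be a set of prime numbers, and let $\{h_p(q):p\in P\}$ be a set of nonzero polynomials in $A[q]$ such that $$h_{p_1}(q)\,\alpha_{u(p_1)}(h_{p_2}(q))=h_{p_2}(q)\,\alpha_{u(p_2)}(h_{p_1}(q))$$ for all $p_1,p_2\in P$. Then there exists a unique sequence $\{f_n(q)\}_{n=1}^\infty$ of polynomials in $A[q]$ satisfying the functional equation $f_{mn}(q)=f_m(q)\,\alpha_{u(m)}(f_n(q))$ for all $m,n\in\mathbf{N}$, such that $f_p(q)=h_p(q)$ for all $p\in P$ and $\{n\in\mathbf{N}: f_n(q)\neq0\}=S(P)$.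
   Context: Semigroup homomorphisms preserve products and identity elements. $\mathbf{N}=\{1,2,3,\dots\}$ is the multiplicative semigroup of positive integers; a homomorphism $u:\mathbf{N}\to\mathbf{N}$ is a completely multiplicative function with $u(1)=1$. $A[q]$ is the multiplicative semigroup of polynomials over $A$. $\mathrm{End}^*(A[q])$ is the semigroup, under composition, of semigroup homomorphisms $\varphi:A[q]\to A[q]$ (so $\varphi(1)=1$, $\varphi(fg)=\varphi(f)\varphi(g)$) with $\varphi(0)=0$ and $\varphi(f)\ne0$ for $f\ne0$; a homomorphism $\alpha:\mathbf{N}\to\mathrm{End}^*(A[q])$ satisfies $\alpha_{mn}=\alpha_m\circ\alpha_n$ and $\alpha_1=\mathrm{id}$, where $\alpha_t$ denotes the image of $t$. For a set $P$ of primes, $S(P)$ is the semigroup of positive integers all of whose prime factors lie in $P$. *)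

theory Defs
  imports
    "HOL-Library.FuncSet"
    "HOL-Computational_Algebra.Polynomial"
    "HOL-Computational_Algebra.Primes"
begin

text \<open>The positive integers are rendered as \<open>{1..} :: nat set\<close>; values at \<open>0\<close> of
  functions whose domain is the positive integers carry no information.\<close>

definition End_star :: "('a::idom poly \<Rightarrow> 'a poly) set" where
  "End_star = {\<phi>. \<phi> 1 = 1 \<and> (\<forall>f g. \<phi> (f * g) = \<phi> f * \<phi> g) \<and>
                  \<phi> 0 = 0 \<and> (\<forall>f. f \<noteq> 0 \<longrightarrow> \<phi> f \<noteq> 0)}"

definition hom_N_End_star :: "(nat \<Rightarrow> 'a::idom poly \<Rightarrow> 'a poly) \<Rightarrow> bool" where
  "hom_N_End_star \<alpha> \<longleftrightarrow> \<alpha> \<in> {1..} \<rightarrow> End_star \<and> \<alpha> 1 = id \<and>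
     (\<forall>m\<in>{1..}. \<forall>n\<in>{1..}. \<alpha> (m * n) = \<alpha> m \<circ> \<alpha> n)"

definition hom_N_N :: "(nat \<Rightarrow> nat) \<Rightarrow> bool" where
  "hom_N_N u \<longleftrightarrow> u \<in> {1..} \<rightarrow> {1..} \<and> u 1 = 1 \<and>
     (\<forall>m\<in>{1..}. \<forall>n\<in>{1..}. u (m * n) = u m * u n)"

definition semigroup_of_primes :: "nat set \<Rightarrow> nat set" where
  "semigroup_of_primes P = {n. n \<ge> 1 \<and> (\<forall>p. prime p \<and> p dvd n \<longrightarrow> p \<in> P)}"

end

theory Submission imports Defs begin

text \<open>Put \<open>T\<^sub>m = \<alpha>\<^bsub>u(m)\<^esub>\<close> and extend \<open>h\<close> by \<open>0\<close> to the primes outside \<open>P\<close>; the compatibility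
  relation then holds for all pairs of primes, because \<open>T\<^sub>m 0 = 0\<close>. A solution must satisfy
  \<open>f\<^sub>1 = 1\<close> and \<open>f\<^bsub>pn\<^esub> = h\<^sub>p T\<^sub>p(f\<^sub>n)\<close> for every prime \<open>p\<close>, which gives uniqueness. For existence, use
  this relation as a recursion that strips off the least prime factor; compatibility together with
  the commutation of the \<open>T\<^sub>p\<close> shows that any other prime factor may be stripped off first.\<close>

text \<open>Every number above 1 is a prime times a smaller positive cofactor, so strong induction
  applies.\<close>

lemma nat_prime_mult_induct [consumes 1, case_names one mult]:
  fixes n :: nat
  assumes "n \<ge> 1" and "Q 1"
    and "\<And>p m. prime p \<Longrightarrow> m \<ge> 1 \<Longrightarrow> Q m \<Longrightarrow> Q (p * m)"
  shows "Q n"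
  using assms(1)
proof (induction n rule: less_induct)
  case (less n)
  show ?case
  proof (cases "n = 1")
    case False
    then obtain p where p: "prime p" "p dvd n"
      using prime_factor_nat by blast
    then obtain m where m: "n = p * m" by blast
    with less.prems have "m \<ge> 1" by (cases m) auto
    moreover have "m < n"
      using m \<open>m \<ge> 1\<close> prime_gt_1_nat[OF p(1)] by simp
    ultimately show ?thesis
      using less.IH assms(3) p(1) m by blast
  qed (use assms(2) in simp)
qed

text \<open>Abstracts \<open>T\<close> to an action of the positive integers by multiplicative maps
  on a domain; the function built below is a crossed homomorphism for this action with prescribed
  values at the primes.\<close>

locale twisted_cocycle =
  fixes T :: "nat \<Rightarrow> 'b::idom \<Rightarrow> 'b" and g :: "nat \<Rightarrow> 'b"
  assumes T_index_1: "T 1 x = x"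
    and T_comp: "m \<ge> 1 \<Longrightarrow> n \<ge> 1 \<Longrightarrow> T (m * n) x = T m (T n x)"
    and T_mult: "m \<ge> 1 \<Longrightarrow> T m (x * y) = T m x * T m y"
    and T_unit: "m \<ge> 1 \<Longrightarrow> T m 1 = 1"
    and T_eq_0_iff: "m \<ge> 1 \<Longrightarrow> T m x = 0 \<longleftrightarrow> x = 0"
    and compat: "prime p \<Longrightarrow> prime q \<Longrightarrow> g p * T p (g q) = g q * T q (g p)"
begin

lemma T_commute: "m \<ge> 1 \<Longrightarrow> n \<ge> 1 \<Longrightarrow> T m (T n x) = T n (T m x)"
  by (metis T_comp mult.commute)

text \<open>The value 1 at 0 is only a default that makes the recursion total.\<close>

function cocycle :: "nat \<Rightarrow> 'b" where
  "cocycle n = (if n \<le> 1 then 1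
          else let p = (LEAST p. prime p \<and> p dvd n) in g p * T p (cocycle (n div p)))"
  by auto
termination
proof (relation "Wellfounded.measure id", simp, clarsimp)
  fix n :: nat
  assume n: "\<not> n \<le> Suc 0"
  then have "\<exists>p. prime p \<and> p dvd n"
    using prime_factor_nat[of n] by auto
  then have "prime (LEAST p. prime p \<and> p dvd n)"
    using LeastI_ex[of "\<lambda>p. prime p \<and> p dvd n"] by simp
  then show "n div (LEAST p. prime p \<and> p dvd n) < n"
    using n prime_gt_1_nat by (intro div_less_dividend) auto
qed

declare cocycle.simps [simp del]

lemma cocycle_1: "cocycle 1 = 1"
  by (simp add: cocycle.simps)

text \<open>Hides the choice of the least prime: later arguments use only that some prime factor was
  stripped.\<close>

lemma cocycle_least_prime_factor:
  assumes "n > 1"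
  obtains q m where "prime q" "n = q * m" "m \<ge> 1" "cocycle n = g q * T q (cocycle m)"
proof -
  define q where "q = (LEAST p. prime p \<and> p dvd n)"
  have "\<exists>p. prime p \<and> p dvd n"
    using assms prime_factor_nat[of n] by auto
  then have q: "prime q" "q dvd n"
    unfolding q_def using LeastI_ex[of "\<lambda>p. prime p \<and> p dvd n"] by simp_all
  have "cocycle n = g q * T q (cocycle (n div q))"
    using assms by (subst cocycle.simps) (simp add: q_def Let_def)
  moreover have "n div q \<ge> 1"
    using q assms by (auto simp: Suc_le_eq div_greater_zero_iff dvd_imp_le prime_gt_0_nat)
  ultimately show thesis
    using that[of q "n div q"] q by simp
qed

text \<open>The recursion strips some prime \<open>q\<close> from \<open>p * n\<close>. If
  \<open>q\<close> differs from \<open>p\<close>, it divides \<open>n\<close>, and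
  \<open>compat\<close> with \<open>T_commute\<close> exchanges the two primes.\<close>

lemma cocycle_prime_mult:
  assumes "prime p" and "n \<ge> 1"
  shows "cocycle (p * n) = g p * T p (cocycle n)"
  using assms(2,1)
proof (induction n arbitrary: p rule: less_induct)
  case (less n)
  have "p * n > 1"
    using prime_gt_1_nat[OF less.prems(2)] less.prems(1) by (simp add: less_le_trans)
  then obtain q k where q: "prime q" and k: "p * n = q * k" "k \<ge> 1"
    and Fq: "cocycle (p * n) = g q * T q (cocycle k)"
    using cocycle_least_prime_factor by metis
  have pq: "p \<ge> 1" "q \<ge> 1"
    using less.prems(2) q prime_ge_1_nat by auto
  show ?case
  proof (cases "q = p")
    case True
    then show ?thesis using k Fq pq by simp
  next
    case False
    then have "\<not> q dvd p"
      using less.prems(2) q primes_dvd_imp_eq by blast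
    moreover have "q dvd p * n"
      using k by simp
    ultimately have "q dvd n"
      using q prime_dvd_mult_iff by blast
    then obtain m where m: "n = q * m" by blast
    with less.prems(1) have m1: "m \<ge> 1" by (cases m) auto
    \<comment> \<open>The induction hypothesis at \<open>m\<close> is needed for both
      \<open>p\<close> and \<open>q\<close>, hence the generalisation over the prime.\<close>
    have "m < n"
      using m m1 prime_gt_1_nat[OF q] by simp
    have "q * k = q * (p * m)"
      using k(1) m by (metis mult.left_commute)
    then have "k = p * m"
      using pq by (metis mult_left_cancel not_one_le_zero)
    then have "cocycle (p * n) = g q * T q (g p * T p (cocycle m))"
      using Fq less.IH[OF \<open>m < n\<close> m1 less.prems(2)] by simp
    also have "\<dots> = g q * T q (g p) * T q (T p (cocycle m))"
      using pq by (simp add: T_mult mult.assoc)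
    also have "\<dots> = g p * T p (g q) * T p (T q (cocycle m))"
      using compat[OF less.prems(2) q] T_commute[OF pq] by simp
    also have "\<dots> = g p * T p (g q * T q (cocycle m))"
      using pq by (simp add: T_mult mult.assoc)
    also have "g q * T q (cocycle m) = cocycle n"
      using less.IH[OF \<open>m < n\<close> m1 q] m by simp
    finally show ?thesis .
  qed
qed

lemma cocycle_mult:
  assumes "m \<ge> 1" and n: "n \<ge> 1"
  shows "cocycle (m * n) = cocycle m * T m (cocycle n)"
  using assms(1)
proof (induction m rule: nat_prime_mult_induct)
  case one
  then show ?case by (simp add: cocycle_1[simplified] T_index_1[simplified])
next
  case (mult p m)
  have p: "p \<ge> 1" using mult prime_ge_1_nat by blast
  have "m * n \<ge> 1" using mult n by simp
  then have "cocycle (p * m * n) = g p * T p (cocycle m * T m (cocycle n))"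
    using cocycle_prime_mult[OF mult(1), of "m * n"] mult by (simp add: mult.assoc)
  also have "\<dots> = cocycle (p * m) * T (p * m) (cocycle n)"
    using p mult by (simp add: T_mult T_comp cocycle_prime_mult mult.assoc)
  finally show ?case .
qed

lemma cocycle_prime: "prime p \<Longrightarrow> cocycle p = g p"
  using cocycle_prime_mult[of p 1] prime_ge_1_nat[of p] by (simp add: cocycle_1[simplified] T_unit[simplified])

text \<open>Each \<open>T p\<close> preserves being nonzero and a domain has no zero divisors, so
  only a factor \<open>g p\<close> can make the value vanish.\<close>

lemma cocycle_nonzero_iff:
  assumes "n \<ge> 1"
  shows "cocycle n \<noteq> 0 \<longleftrightarrow> (\<forall>p. prime p \<and> p dvd n \<longrightarrow> g p \<noteq> 0)"
  using assms
proof (induction n rule: nat_prime_mult_induct)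
  case one
  then show ?case by (auto simp: cocycle_1[simplified])
next
  case (mult p m)
  have "p \<ge> 1" using mult prime_ge_1_nat by blast
  then have "cocycle (p * m) \<noteq> 0 \<longleftrightarrow> g p \<noteq> 0 \<and> cocycle m \<noteq> 0"
    using mult by (simp add: cocycle_prime_mult T_eq_0_iff)
  moreover have "prime q \<and> q dvd p * m \<longleftrightarrow> q = p \<or> prime q \<and> q dvd m" for q
    using mult(1) primes_dvd_imp_eq[of q p] prime_dvd_mult_iff[of q p m] by auto
  ultimately show ?case
    using mult.IH by auto
qed

end

text \<open>Stripping primes one at a time reduces every value to those at 1 and at the
  primes.\<close>

lemma twisted_cocycle_unique:
  fixes f f' :: "nat \<Rightarrow> 'b::idom"
  assumes "\<And>m n. m \<ge> 1 \<Longrightarrow> n \<ge> 1 \<Longrightarrow> f (m * n) = f m * T m (f n)"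
    and "\<And>m n. m \<ge> 1 \<Longrightarrow> n \<ge> 1 \<Longrightarrow> f' (m * n) = f' m * T m (f' n)"
    and "f 1 = f' 1" and "\<And>p. prime p \<Longrightarrow> f p = f' p" and "n \<ge> 1"
  shows "f n = f' n"
  using assms(5)
proof (induction n rule: nat_prime_mult_induct)
  case (mult p m)
  then show ?case
    using assms(1,2,4) prime_ge_1_nat[of p] by simp
qed (use assms(3) in simp)

theorem theorem5:
  fixes \<alpha> :: "nat \<Rightarrow> 'a::idom poly \<Rightarrow> 'a poly"
    and u :: "nat \<Rightarrow> nat"
    and P :: "nat set"
    and h :: "nat \<Rightarrow> 'a poly"
  assumes "hom_N_End_star \<alpha>"
    and "hom_N_N u"
    and "\<forall>p\<in>P. prime p"
    and "\<forall>p\<in>P. h p \<noteq> 0"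
    and "\<forall>p\<^sub>1\<in>P. \<forall>p\<^sub>2\<in>P. h p\<^sub>1 * \<alpha> (u p\<^sub>1) (h p\<^sub>2) = h p\<^sub>2 * \<alpha> (u p\<^sub>2) (h p\<^sub>1)"
  shows "\<exists>!f. f \<in> {1..} \<rightarrow>\<^sub>E (UNIV :: 'a poly set) \<and>
           (\<forall>m\<in>{1..}. \<forall>n\<in>{1..}. f (m * n) = f m * \<alpha> (u m) (f n)) \<and>
           (\<forall>p\<in>P. f p = h p) \<and>
           {n\<in>{1..}. f n \<noteq> 0} = semigroup_of_primes P"
proof -
  define T where "T m = \<alpha> (u m)" for m
  \<comment> \<open>The value 0 outside \<open>P\<close> is forced by the support condition.\<close>
  define g where "g p = (if p \<in> P then h p else 0)" for p
  have u: "u m \<ge> 1" if "m \<ge> 1" for m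
    using assms(2) that by (auto simp: hom_N_N_def)
  have E: "T m \<in> End_star" if "m \<ge> 1" for m
    using assms(1) u[OF that] by (auto simp: hom_N_End_star_def T_def)
  interpret twisted_cocycle T g
  proof
    show "T 1 x = x" for x
      using assms(1,2) by (simp add: T_def hom_N_End_star_def hom_N_N_def)
    show "T (m * n) x = T m (T n x)" if "m \<ge> 1" "n \<ge> 1" for m n x
      using assms(1,2) u that by (simp add: T_def hom_N_End_star_def hom_N_N_def)
    show "T m (x * y) = T m x * T m y" if "m \<ge> 1" for m x y
      using E[OF that] by (simp add: End_star_def)
    show "T m 1 = 1" if "m \<ge> 1" for m
      using E[OF that] by (simp add: End_star_def)
    show T0: "T m x = 0 \<longleftrightarrow> x = 0" if "m \<ge> 1" for m x
      using E[OF that] by (auto simp: End_star_def)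
    show "g p * T p (g q) = g q * T q (g p)" if "prime p" "prime q" for p q
      \<comment> \<open>If either prime lies outside \<open>P\<close>, both sides vanish since
        \<open>T\<close> fixes 0.\<close>
      using assms(5) T0[of p 0] T0[of q 0] that[THEN prime_ge_1_nat]
      by (auto simp: g_def T_def)
  qed
  have g_nonzero: "g p \<noteq> 0 \<longleftrightarrow> p \<in> P" for p
    using assms(4) by (simp add: g_def)
  have determined: "f 1 = 1 \<and> (\<forall>p. prime p \<longrightarrow> f p = g p)"
    if mult: "\<forall>m\<in>{1..}. \<forall>n\<in>{1..}. f (m * n) = f m * \<alpha> (u m) (f n)"
      and h: "\<forall>p\<in>P. f p = h p"
      and supp: "{n\<in>{1..}. f n \<noteq> 0} = semigroup_of_primes P" for f
  proof (intro conjI allI impI)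
    have "1 \<in> semigroup_of_primes P"
      by (auto simp: semigroup_of_primes_def)
    then have "f 1 \<noteq> 0"
      using supp by blast
    \<comment> \<open>A nonzero idempotent of a domain is 1.\<close>
    moreover have "f 1 = f 1 * f 1"
      using mult[rule_format, of 1 1] T_index_1[of "f 1"] by (simp add: T_def)
    ultimately show "f 1 = 1"
      by simp
  next
    fix p :: nat
    assume p: "prime p"
    show "f p = g p"
    proof (cases "p \<in> P")
      case False
      then have "p \<notin> semigroup_of_primes P"
        using p by (auto simp: semigroup_of_primes_def)
      then have "p \<notin> {n\<in>{1..}. f n \<noteq> 0}"
        using supp by simp
      then show ?thesis
        using p False prime_ge_1_nat by (auto simp: g_def)
    qed (use h in \<open>simp add: g_def\<close>)
  qed
  show ?thesis
  \<comment> \<open>Restriction makes the value at 0 \<open>undefined\<close>, as extensionality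
    demands; uniqueness then holds as equality of functions.\<close>
  proof (rule ex1I[of _ "restrict cocycle {1..}"], goal_cases)
    case 1
    have "{n\<in>{1..}. restrict cocycle {1..} n \<noteq> 0} = semigroup_of_primes P"
      using cocycle_nonzero_iff by (auto simp: semigroup_of_primes_def g_nonzero)
    moreover have "restrict cocycle {1..} p = h p" if "p \<in> P" for p
      using that assms(3) cocycle_prime[of p] prime_ge_1_nat[of p] by (simp add: g_def)
    moreover have "restrict cocycle {1..} (m * n)
        = restrict cocycle {1..} m * \<alpha> (u m) (restrict cocycle {1..} n)"
      if "m \<ge> 1" "n \<ge> 1" for m n
    proof -
      have "m * n \<ge> 1" using that by simp
      then show ?thesis
        using that cocycle_mult[OF that] by (simp add: T_def)
    qed
    ultimately show ?case
      by simp
  next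
    case (2 f)
    have v: "f 1 = 1" "\<And>p. prime p \<Longrightarrow> f p = g p"
      using determined[of f] 2 by blast+
    have "f n = cocycle n" if "n \<ge> 1" for n
    proof (rule twisted_cocycle_unique[of f T cocycle])
      show "f (m * n) = f m * T m (f n)" if "m \<ge> 1" "n \<ge> 1" for m n
        using 2 that by (simp add: T_def)
      show "f 1 = cocycle 1"
        unfolding cocycle_1 by (rule v(1))
    qed (use that v(2) cocycle_mult cocycle_prime in simp_all)
    then show ?case
      using 2 by (auto intro!: extensionalityI[of _ "{1..}"] simp: PiE_def)
  qed
qed

end
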